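(* Let $\lambda$ be a nonzero real number. Define the degenerate A-algorithm matrix $(b_{n,m}(\lambda))_{n,m\ge0}$ by $b_{0,m}(\lambda)=(1/2)^m$ for $m\ge0$ and \[ b_{n,m}(\lambda)=(m+1)\Big(\Big(1-\frac{(n-1)\lambda}{m+1}\Big)b_{n-1,m}(\lambda)-b_{n-1,m+1}(\lambda)\Big),\qquad n\ge1,\ m\ge0. \] Then for every $n\ge0$, \[ b_{n,0}(\lambda)=\sum_{k=0}^{n}(-1)^{k}k!\Big({n+1 \brace k+1}_{\lambda}+n\lambda {n \brace k+1}_{\lambda}\Big)\Big(\frac12\Big)^{k}=\mathcal{E}_{n,\lambda}(1), \] and for every $n\ge1$, \[ \sum_{k=0}^{n}S_{1,\lambda}(n,k)\,\mathcal{E}_{k,\lambda}(1)=(-1)^{n-1}\frac{n!}{2^{n}}. \]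
   Context: For $n\ge0$ set $(x)_{0,\lambda}=1$, $(x)_{n,\lambda}=x(x-\lambda)\cdots(x-(n-1)\lambda)$ for $n\ge1$, and $(x)_0=1$, $(x)_n=x(x-1)\cdots(x-n+1)$ for $n\ge1$. The degenerate exponential is $e_\lambda^x(t)=\sum_{k\ge0}(x)_{k,\lambda}\frac{t^k}{k!}$ (i.e. $(1+\lambda t)^{x/\lambda}$), $e_\lambda(t)=e_\lambda^1(t)$, and $\log_\lambda$ is the compositional inverse of $e_\lambda$, so $\log_\lambda(1+t)=\sum_{n\ge1}\frac{(-1)^{n-1}}{n}\binom{n-1-\lambda}{n-1}t^n$. The degenerate Stirling numbers of the second kind ${n \brace k}_{\lambda}$ are defined by $(x)_{n,\lambda}=\sum_{k=0}^{n}{n \brace k}_{\lambda}(x)_{k}$ (zero for $k>n$); the degenerate Stirling numbers of the first kind $S_{1,\lambda}(n,k)$ are defined by $\frac{1}{k!}(\log_\lambda(1+t))^k=\sum_{n\ge k}S_{1,\lambda}(n,k)\frac{t^n}{n!}$. The degenerate Euler polynomials are defined by $\frac{2}{e_\lambda(t)+1}e_\lambda^x(t)=\sum_{n\ge0}\mathcal{E}_{n,\lambda}(x)\frac{t^n}{n!}$. *)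

theory Defs
  imports "HOL-Computational_Algebra.Computational_Algebra"
begin

unbundle fps_syntax

text \<open>The degenerate falling factorial; the ordinary one is the case \<open>lam = 1\<close>.\<close>

definition dff :: "real \<Rightarrow> real \<Rightarrow> nat \<Rightarrow> real" where
  "dff lam x n = (\<Prod>i<n. x - real i * lam)"

abbreviation ff :: "real \<Rightarrow> nat \<Rightarrow> real" where
  "ff x n \<equiv> dff 1 x n"

definition dexp :: "real \<Rightarrow> real \<Rightarrow> real fps" where
  "dexp lam x = Abs_fps (\<lambda>k. dff lam x k / fact k)"

text \<open>
  The series \<open>log_lam(1 + t)\<close>: that \<open>log_lam\<close> is the compositional inverse of \<open>e_lam\<close> means that
  \<open>log_lam(1 + t)\<close> is the compositional inverse of \<open>e_lam(t) - 1\<close>, a series without constant term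
  and with linear coefficient 1.
\<close>

definition dlog1p :: "real \<Rightarrow> real fps" where
  "dlog1p lam = fps_inv (dexp lam 1 - 1)"

lemma dexp_minus_1_nth: "(dexp lam 1 - 1) $ 0 = 0" "(dexp lam 1 - 1) $ 1 = 1"
  by (simp_all add: dexp_def dff_def)

lemma dlog1p_compose:
  "dlog1p lam oo (dexp lam 1 - 1) = fps_X" "(dexp lam 1 - 1) oo dlog1p lam = fps_X"
  using dexp_minus_1_nth [of lam] unfolding dlog1p_def
  by (simp_all add: fps_inv fps_inv_right)

definition dStirling1 :: "real \<Rightarrow> nat \<Rightarrow> nat \<Rightarrow> real" where
  "dStirling1 lam n k = fact n * ((fps_const (1 / fact k) * dlog1p lam ^ k) $ n)"

definition dStirling2 :: "real \<Rightarrow> nat \<Rightarrow> nat \<Rightarrow> real" where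
  "dStirling2 lam n = (THE c. (\<forall>k>n. c k = 0) \<and> (\<forall>x. dff lam x n = (\<Sum>k=0..n. c k * ff x k)))"

lemma dff_Suc: "dff lam x (Suc n) = dff lam x n * (x - real n * lam)"
  by (simp add: dff_def)

lemma dStirling2_ex:
  "\<exists>c. (\<forall>k>n. c k = 0) \<and> (\<forall>x. dff lam x n = (\<Sum>k=0..n. c k * ff x k))"
proof (induction n)
  case 0
  show ?case by (rule exI [of _ "\<lambda>k. if k = 0 then 1 else 0"]) (simp add: dff_def)
next
  case (Suc n)
  then obtain c where c0: "\<And>k. k > n \<Longrightarrow> c k = 0"
    and c: "\<And>x. dff lam x n = (\<Sum>k=0..n. c k * ff x k)" by blast
  define d where "d k = (if k = 0 then 0 else c (k - 1)) + (real k - real n * lam) * c k" for k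
  have "dff lam x (Suc n) = (\<Sum>k=0..Suc n. d k * ff x k)" for x
  proof -
    have "dff lam x (Suc n) = (\<Sum>k=0..n. c k * ff x k * (x - real n * lam))"
      by (simp add: dff_Suc c sum_distrib_right)
    also have "\<dots> = (\<Sum>k=0..n. c k * ff x (Suc k) + (real k - real n * lam) * c k * ff x k)"
      by (intro sum.cong) (simp_all add: dff_Suc algebra_simps)
    also have "\<dots> = (\<Sum>k=0..n. c k * ff x (Suc k)) + (\<Sum>k=0..n. (real k - real n * lam) * c k * ff x k)"
      by (simp add: sum.distrib)
    also have "(\<Sum>k=0..n. c k * ff x (Suc k))
        = (\<Sum>k=0..Suc n. (if k = 0 then 0 else c (k - 1)) * ff x k)"
      by (subst sum.atLeast0_atMost_Suc_shift) simp
    also have "(\<Sum>k=0..n. (real k - real n * lam) * c k * ff x k)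
        = (\<Sum>k=0..Suc n. (real k - real n * lam) * c k * ff x k)"
      by (simp add: c0)
    finally show ?thesis
      by (simp add: d_def sum.distrib distrib_right)
  qed
  moreover have "\<forall>k>Suc n. d k = 0" by (auto simp: d_def c0)
  ultimately show ?case by blast
qed

lemma ff_eq_0: "j < k \<Longrightarrow> ff (real j) k = 0"
  by (auto simp: dff_def)

lemma ff_diag: "ff (real k) k \<noteq> 0"
  by (auto simp: dff_def)

lemma ff_coeffs_unique:
  assumes "\<forall>k>n. c k = 0" "\<forall>k>n. d k = 0"
    and "\<forall>x. (\<Sum>k=0..n. c k * ff x k) = (\<Sum>k=0..n. d k * ff x k)"
  shows "c = d"
proof
  have *: "(\<Sum>k=0..n. (c k - d k) * ff x k) = 0" for x
    using assms(3) by (simp add: left_diff_distrib sum_subtractf)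
  fix j show "c j = d j"
  proof (induction j rule: less_induct)
    case (less j)
    show ?case
    proof (cases "j \<le> n")
      case True
      have "0 = (\<Sum>k=0..n. (c k - d k) * ff (real j) k)" using * by simp
      also have "\<dots> = (\<Sum>k\<in>{j}. (c k - d k) * ff (real j) k)"
      proof (rule sum.mono_neutral_right)
        show "\<forall>k\<in>{0..n} - {j}. (c k - d k) * ff (real j) k = 0"
        proof
          fix k assume "k \<in> {0..n} - {j}"
          then have "k < j \<or> j < k" by auto
          then show "(c k - d k) * ff (real j) k = 0"
            using less.IH [of k] ff_eq_0 [of j k] by auto
        qed
      qed (use True in auto)
      finally show ?thesis using ff_diag [of j] by simp
    next
      case False
      then show ?thesis using assms by simp
    qed
  qed
qed

lemma dStirling2_ex1:
  "\<exists>!c. (\<forall>k>n. c k = 0) \<and> (\<forall>x. dff lam x n = (\<Sum>k=0..n. c k * ff x k))"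
proof (rule ex_ex1I [OF dStirling2_ex])
  fix c d
  assume c: "(\<forall>k>n. c k = 0) \<and> (\<forall>x. dff lam x n = (\<Sum>k=0..n. c k * ff x k))"
    and d: "(\<forall>k>n. d k = 0) \<and> (\<forall>x. dff lam x n = (\<Sum>k=0..n. d k * ff x k))"
  have "(\<Sum>k=0..n. c k * ff x k) = (\<Sum>k=0..n. d k * ff x k)" for x
    by (rule trans [OF c [THEN conjunct2, THEN spec, symmetric] d [THEN conjunct2, THEN spec]])
  then show "c = d"
    by (intro ff_coeffs_unique [OF c [THEN conjunct1] d [THEN conjunct1]] allI)
qed

lemmas dStirling2_spec = theI' [OF dStirling2_ex1, folded dStirling2_def]

lemma dStirling2_eq_0: "k > n \<Longrightarrow> dStirling2 lam n k = 0"
  by (rule dStirling2_spec [THEN conjunct1, THEN spec, THEN mp])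

lemma dff_eq_sum_dStirling2: "dff lam x n = (\<Sum>k=0..n. dStirling2 lam n k * ff x k)"
  by (rule dStirling2_spec [THEN conjunct2, THEN spec])

definition dEuler :: "real \<Rightarrow> nat \<Rightarrow> real \<Rightarrow> real" where
  "dEuler lam n x = fact n * ((2 / (dexp lam 1 + 1) * dexp lam x) $ n)"

primrec dA_matrix :: "real \<Rightarrow> nat \<Rightarrow> nat \<Rightarrow> real" where
  "dA_matrix lam 0 m = (1 / 2) ^ m"
| "dA_matrix lam (Suc n) m =
     (real m + 1) * ((1 - real n * lam / (real m + 1)) * dA_matrix lam n m - dA_matrix lam n (m + 1))"

end

theory Submission
  imports Defs
begin

text \<open>
  Write \<open>e\<close> for \<open>e_lam(t)\<close>, so that \<open>(1 + lam t) e' = e\<close>. The series \<open>G = e / (e + 1)\<close> then satisfies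
  \<open>(1 + lam t) G' = G - G\<^sup>2\<close>, hence \<open>(1 + lam t) (G^(m+1))' = (m + 1) (G^(m+1) - G^(m+2))\<close>, which on
  coefficients is the recurrence of the matrix: column \<open>m\<close> has exponential generating function
  \<open>2 G^(m+1)\<close>, and the case \<open>m = 0\<close> is the generating function of the Euler numbers at 1. Expanding
  \<open>2 G = e / (1 + (e - 1) / 2)\<close> as a geometric series in \<open>e - 1\<close> gives the Stirling sum, and composing
  with \<open>log_lam(1 + t)\<close> turns \<open>2 G\<close> into \<open>2 (1 + t) / (2 + t)\<close>.
\<close>

lemma dexp_nth_0 [simp]: "dexp lam x $ 0 = 1"
  by (simp add: dexp_def dff_def)

lemma fps_nth_X_deriv:
  fixes H :: "real fps"
  shows "((1 + fps_const lam * fps_X) * fps_deriv H) $ n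
       = real (Suc n) * H $ Suc n + real n * lam * H $ n"
proof -
  have "((1 + fps_const lam * fps_X) * fps_deriv H) $ n
      = fps_deriv H $ n + lam * (fps_X * fps_deriv H) $ n"
    by (simp add: distrib_right mult.assoc del: fps_deriv_nth fps_X_mult_nth)
  then show ?thesis by (cases n) simp_all
qed

text \<open>Passage from differential equations to recurrences for the numbers
  \<open>fact n * H $ n\<close>: the derivative shifts the index and the \<open>lam * t\<close> part
  contributes \<open>n * lam\<close>. Every recurrence below arises this way.\<close>

lemma fact_nth_Suc:
  fixes H K :: "real fps"
  assumes "(1 + fps_const lam * fps_X) * fps_deriv H = K"
  shows "fact (Suc n) * H $ Suc n + real n * lam * (fact n * H $ n) = fact n * K $ n"
  unfolding assms [symmetric] fps_nth_X_deriv by (simp add: algebra_simps)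

text \<open>On coefficients this is \<open>dff_Suc\<close>: the new factor
  \<open>x - n * lam\<close> splits into the right-hand side and the term produced by
  \<open>lam * t\<close>.\<close>

lemma dexp_ODE:
  "(1 + fps_const lam * fps_X) * fps_deriv (dexp lam x) = fps_const x * dexp lam x"
proof (rule fps_ext)
  fix n
  have "real (Suc n) * dexp lam x $ Suc n = dexp lam x $ n * (x - real n * lam)"
    by (simp add: dexp_def dff_Suc field_simps del: of_nat_Suc)
  then show "((1 + fps_const lam * fps_X) * fps_deriv (dexp lam x)) $ n
      = (fps_const x * dexp lam x) $ n"
    by (simp only: fps_nth_X_deriv fps_mult_left_const_nth) (simp add: algebra_simps)
qed

lemma dexp_1_ODE: "(1 + fps_const lam * fps_X) * fps_deriv (dexp lam 1) = dexp lam 1"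
  using dexp_ODE [of lam 1] by simp

lemma dexp_minus_1_power_ODE:
  "(1 + fps_const lam * fps_X) * fps_deriv ((dexp lam 1 - 1) ^ Suc k)
     = of_nat (Suc k) * ((dexp lam 1 - 1) ^ k * dexp lam 1)"
proof -
  have "fps_deriv ((dexp lam 1 - 1) ^ Suc k)
      = of_nat (Suc k) * ((dexp lam 1 - 1) ^ k * fps_deriv (dexp lam 1))"
    by (subst fps_deriv_power') (simp add: mult_ac)
  then show ?thesis by (metis dexp_1_ODE mult.left_commute)
qed

text \<open>The scaled coefficients of \<open>(e - 1)^k / k!\<close> obey a triangular recurrence,
  which makes them expand \<open>dff lam x n\<close> in falling factorials. Uniqueness of such an
  expansion identifies them with \<open>dStirling2\<close>.\<close>

lemma dStirling2_egf:
  "dStirling2 lam n k = fact n * ((dexp lam 1 - 1) ^ k) $ n / fact k"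
proof -
  let ?y = "dexp lam 1 - 1"
  define c where "c n k = fact n * (?y ^ k) $ n / fact k" for n k
  have c0: "c n k = 0" if "k > n" for n k
    using that by (simp add: c_def startsby_zero_power_prefix dexp_minus_1_nth)
  have c_Suc_0: "c (Suc n) 0 = 0" for n by (simp add: c_def)
  have c_Suc: "c (Suc n) (Suc k) = c n k + (real (Suc k) - real n * lam) * c n (Suc k)" for n k
  proof -
    \<comment> \<open>Splitting \<open>e\<close> as \<open>(e - 1) + 1\<close> produces the two
      terms of the recurrence.\<close>
    have "?y ^ k * dexp lam 1 = ?y ^ Suc k + ?y ^ k" by (simp add: algebra_simps)
    then have "(of_nat (Suc k) * (?y ^ k * dexp lam 1)) $ n
        = real (Suc k) * ((?y ^ Suc k) $ n + (?y ^ k) $ n)"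
      by (simp only: fps_of_nat [symmetric] fps_mult_left_const_nth fps_add_nth)
    then have "fact (Suc n) * (?y ^ Suc k) $ Suc n + real n * lam * (fact n * (?y ^ Suc k) $ n)
        = fact n * (real (Suc k) * ((?y ^ Suc k) $ n + (?y ^ k) $ n))"
      using fact_nth_Suc [OF dexp_minus_1_power_ODE [of lam k], of n] by simp
    then show ?thesis
      unfolding c_def fact_Suc [of k]
      by (simp add: divide_simps algebra_simps del: of_nat_Suc power_Suc fact_Suc)
  qed
  have sum_c: "dff lam x n = (\<Sum>k=0..n. c n k * ff x k)" for x n
  proof (induction n)
    case 0
    show ?case by (simp add: c_def dff_def)
  next
    case (Suc n)
    have "(\<Sum>k=0..Suc n. c (Suc n) k * ff x k)
        = (\<Sum>k=0..n. c n k * ff x (Suc k))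
          + (\<Sum>k=0..n. (real (Suc k) - real n * lam) * c n (Suc k) * ff x (Suc k))"
      by (subst sum.atLeast0_atMost_Suc_shift)
        (simp add: c_Suc_0 c_Suc distrib_right sum.distrib del: of_nat_Suc)
    \<comment> \<open>Reindexing to start at 0 adds the term \<open>- n * lam * c n 0\<close>, which
      has to be compensated. The correction vanishes: \<open>c n 0 = 0\<close> for
      \<open>n > 0\<close>, and the factor \<open>n\<close> handles \<open>n = 0\<close>.\<close>
    also have "(\<Sum>k=0..n. (real (Suc k) - real n * lam) * c n (Suc k) * ff x (Suc k))
        = (\<Sum>k=0..Suc n. (real k - real n * lam) * c n k * ff x k) + real n * lam * c n 0"
      using sum.atLeast0_atMost_Suc_shift
        [of "\<lambda>k. (real k - real n * lam) * c n k * ff x k" n]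
      by (simp add: dff_def del: sum.atLeast0_atMost_Suc)
    also have "\<dots> = (\<Sum>k=0..n. (real k - real n * lam) * c n k * ff x k) + real n * lam * c n 0"
      by (simp add: c0)
    also have "real n * lam * c n 0 = 0" by (simp add: c_def)
    finally have "(\<Sum>k=0..Suc n. c (Suc n) k * ff x k)
        = (\<Sum>k=0..n. c n k * ff x k * (x - real n * lam))"
      by (simp add: sum.distrib [symmetric] dff_Suc algebra_simps)
    then show ?case by (simp only: dff_Suc Suc sum_distrib_right)
  qed
  have "dStirling2 lam n = c n"
  proof (rule ff_coeffs_unique [of n])
    show "\<forall>k>n. dStirling2 lam n k = 0" by (simp add: dStirling2_eq_0)
    show "\<forall>k>n. c n k = 0" by (simp add: c0)
    show "\<forall>x. (\<Sum>k=0..n. dStirling2 lam n k * ff x k) = (\<Sum>k=0..n. c n k * ff x k)"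
      by (metis dff_eq_sum_dStirling2 sum_c)
  qed
  then show ?thesis by (simp add: c_def)
qed

text \<open>The summand \<open>n * lam\<close> completes the shift in \<open>n\<close> to the
  operator \<open>(1 + lam t) d/dt\<close>, which sends \<open>(e - 1)^(k+1) / (k+1)!\<close> to
  \<open>(e - 1)^k e / k!\<close>.\<close>

lemma dStirling2_shift:
  "fact k * (dStirling2 lam (n + 1) (k + 1) + real n * lam * dStirling2 lam n (k + 1))
     = fact n * ((dexp lam 1 - 1) ^ k * dexp lam 1) $ n"
proof -
  let ?y = "dexp lam 1 - 1"
  have "fact (Suc n) * (?y ^ Suc k) $ Suc n + real n * lam * (fact n * (?y ^ Suc k) $ n)
      = fact n * (real (Suc k) * (?y ^ k * dexp lam 1) $ n)"
    using fact_nth_Suc [OF dexp_minus_1_power_ODE [of lam k], of n]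
    by (simp only: fps_of_nat [symmetric] fps_mult_left_const_nth)
  then show ?thesis
    unfolding dStirling2_egf Suc_eq_plus1 [symmetric] fact_Suc [of k]
    by (simp add: divide_simps algebra_simps del: of_nat_Suc power_Suc fact_Suc)
qed

lemma dexp_plus_1_cancel: "(dexp lam 1 + 1) * inverse (dexp lam 1 + 1) = 1"
  by (subst mult.commute, rule inverse_mult_eq_1) simp

lemma dEuler_egf: "2 / (dexp lam 1 + 1) * dexp lam x = 2 * dexp lam x * inverse (dexp lam 1 + 1)"
  by (subst fps_divide_unit) (simp_all add: mult_ac)

lemma dA_matrix_egf:
  "dA_matrix lam n m = fact n * (2 * (dexp lam 1 * inverse (dexp lam 1 + 1)) ^ Suc m) $ n"
proof -
  let ?e = "dexp lam 1" and ?i = "inverse (dexp lam 1 + 1)" and ?D = "1 + fps_const lam * fps_X"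
  let ?G = "?e * ?i"
  have deriv_i: "fps_deriv ?i = - fps_deriv ?e * ?i\<^sup>2"
    by (subst fps_inverse_deriv) simp_all
  \<comment> \<open>This turns \<open>e' * i^2\<close> into \<open>e' * i * (1 - G)\<close>, so that
    \<open>(1 + lam t) e' = e\<close> yields \<open>G * (1 - G)\<close>.\<close>
  have G1: "1 - ?G = ?i"
    using dexp_plus_1_cancel [of lam] by (simp add: algebra_simps)
  have "fps_deriv ?G = fps_deriv ?e * (?i * (1 - ?G))"
    by (simp only: fps_deriv_mult deriv_i) (simp add: algebra_simps power2_eq_square)
  then have "?D * fps_deriv ?G = (?D * fps_deriv ?e) * (?i * (1 - ?G))"
    by (simp only: mult.assoc)
  then have G: "?D * fps_deriv ?G = ?G * (1 - ?G)"
    by (simp only: dexp_1_ODE mult.assoc)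
  have ODE: "?D * fps_deriv (2 * ?G ^ Suc m)
      = of_nat (Suc m) * (2 * ?G ^ Suc m - 2 * ?G ^ Suc (Suc m))" for m
  proof -
    have "fps_deriv (2 * ?G ^ Suc m) = 2 * fps_deriv (?G ^ Suc m)"
      by (simp only: fps_deriv_mult_const_left numeral_fps_const)
    also have "\<dots> = 2 * (of_nat (Suc m) * fps_deriv ?G * ?G ^ m)"
      by (simp only: fps_deriv_power' diff_Suc_1)
    finally have "?D * fps_deriv (2 * ?G ^ Suc m)
        = 2 * of_nat (Suc m) * ((?D * fps_deriv ?G) * ?G ^ m)"
      by (simp only: mult_ac)
    also have "\<dots> = 2 * of_nat (Suc m) * (?G * (1 - ?G) * ?G ^ m)"
      by (simp only: G)
    finally have "?D * fps_deriv (2 * ?G ^ Suc m)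
        = 2 * of_nat (Suc m) * (?G * (1 - ?G) * ?G ^ m)" .
    then show ?thesis by (simp add: algebra_simps)
  qed
  show ?thesis
  proof (induction n arbitrary: m)
    case 0
    \<comment> \<open>The constant term of \<open>G\<close> is 1/2; the factor 2 adjusts its power
      \<open>m + 1\<close> to the initial row.\<close>
    have "2 * (1 / 2) ^ Suc m = (1 / 2 :: real) ^ m" by simp
    then show ?case by (simp add: fps_power_zeroth fps_mult_nth_0 numeral_fps_const)
  next
    case (Suc n)
    have "(of_nat (Suc m) * (2 * ?G ^ Suc m - 2 * ?G ^ Suc (Suc m))) $ n
        = real (Suc m) * ((2 * ?G ^ Suc m) $ n - (2 * ?G ^ Suc (Suc m)) $ n)"
      by (simp only: fps_of_nat [symmetric] fps_mult_left_const_nth fps_sub_nth)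
    with fact_nth_Suc [OF ODE [of m], of n]
    have "fact (Suc n) * (2 * ?G ^ Suc m) $ Suc n + real n * lam * dA_matrix lam n m
        = real (Suc m) * (dA_matrix lam n m - dA_matrix lam n (m + 1))"
      by (simp only: Suc) (simp add: algebra_simps)
    moreover have "dA_matrix lam (Suc n) m
        = real (Suc m) * (dA_matrix lam n m - dA_matrix lam n (m + 1)) - real n * lam * dA_matrix lam n m"
      by (simp add: field_simps)
    ultimately show ?case by linarith
  qed
qed

lemma dA_matrix_eq_dEuler: "dA_matrix lam n 0 = dEuler lam n 1"
  unfolding dA_matrix_egf dEuler_def dEuler_egf by (simp add: mult.assoc)

text \<open>With \<open>z = -(e - 1) / 2\<close> one has \<open>2 (1 - z) = e + 1\<close>, so
  \<open>2 e / (e + 1) = e / (1 - z)\<close>. A geometric sum up to \<open>n\<close> suffices, since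
  its remainder does not reach the coefficient of \<open>t^n\<close>.\<close>

lemma dEuler_eq_sum_dStirling2:
  "(\<Sum>k=0..n. (-1) ^ k * fact k *
      (dStirling2 lam (n + 1) (k + 1) + real n * lam * dStirling2 lam n (k + 1)) * (1 / 2) ^ k)
     = dEuler lam n 1"
proof -
  let ?e = "dexp lam 1" and ?i = "inverse (dexp lam 1 + 1)"
  let ?z = "fps_const (- 1 / 2) * (?e - 1)"
  have half: "2 * fps_const (1 / 2 :: real) = 1"
    by (simp add: numeral_fps_const)
  have z: "2 * (1 - ?z) = ?e + 1"
  proof -
    have "?z = - (fps_const (1 / 2) * (?e - 1))"
      by (metis divide_minus_left fps_const_neg mult_minus_left)
    then have "2 * (1 - ?z) = 2 + (2 * fps_const (1 / 2)) * (?e - 1)"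
      by (simp only: diff_minus_eq_add distrib_left mult_1_right mult.assoc)
    then show ?thesis by (simp only: half) simp
  qed
  have "?e * (\<Sum>k\<le>n. ?z ^ k) = ?e * (\<Sum>k\<le>n. ?z ^ k) * ((?e + 1) * ?i)"
    by (simp add: dexp_plus_1_cancel)
  also have "\<dots> = 2 * ?e * ?i * ((1 - ?z) * (\<Sum>k\<le>n. ?z ^ k))"
    by (simp only: z [symmetric] mult_ac)
  also have "(1 - ?z) * (\<Sum>k\<le>n. ?z ^ k) = 1 - ?z ^ Suc n"
    by (rule sum_gp_basic)
  finally have geometric: "?e * (\<Sum>k\<le>n. ?z ^ k) = 2 * ?e * ?i - ?z ^ Suc n * (2 * ?e * ?i)"
    by (simp add: algebra_simps)
  \<comment> \<open>\<open>z\<close> has no constant term, so \<open>z^(n+1)\<close> starts beyond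
    degree \<open>n\<close>.\<close>
  have vanish: "(?z ^ Suc n * F) $ n = 0" for F
    by (simp add: fps_mult_nth startsby_zero_power_prefix del: power_Suc)
  have "(\<Sum>k=0..n. (-1) ^ k * fact k *
      (dStirling2 lam (n + 1) (k + 1) + real n * lam * dStirling2 lam n (k + 1)) * (1 / 2) ^ k)
      = (\<Sum>k\<le>n. fact n * (?e * ?z ^ k) $ n)"
    unfolding atMost_atLeast0
  proof (rule sum.cong [OF refl])
    fix k
    let ?S = "dStirling2 lam (n + 1) (k + 1) + real n * lam * dStirling2 lam n (k + 1)"
    have pow: "(- 1 / 2 :: real) ^ k = (-1) ^ k * (1 / 2) ^ k"
      by (simp flip: power_mult_distrib)
    have "(?e * ?z ^ k) $ n = (- 1 / 2) ^ k * ((?e - 1) ^ k * ?e) $ n"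
      by (simp only: power_mult_distrib fps_const_power mult.commute [of ?e] mult.assoc
            fps_mult_left_const_nth)
    then have "fact n * (?e * ?z ^ k) $ n = (- 1 / 2) ^ k * (fact k * ?S)"
      by (simp only: dStirling2_shift mult.left_commute)
    then show "(-1) ^ k * fact k * ?S * (1 / 2) ^ k = fact n * (?e * ?z ^ k) $ n"
      by (simp only: pow mult_ac)
  qed
  also have "\<dots> = fact n * (?e * (\<Sum>k\<le>n. ?z ^ k)) $ n"
    by (simp only: sum_distrib_left fps_sum_nth)
  also have "\<dots> = fact n * (2 * ?e * ?i) $ n"
    by (simp only: geometric fps_sub_nth vanish diff_zero)
  finally show ?thesis by (simp only: dEuler_def dEuler_egf)
qed

text \<open>The \<open>k!\<close> cancels against the \<open>1 / k!\<close> in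
  \<open>dStirling1\<close>, leaving the coefficient formula for composition.\<close>

lemma sum_dStirling1:
  "(\<Sum>k=0..n. dStirling1 lam n k * (fact k * H $ k)) = fact n * (H oo dlog1p lam) $ n"
  by (simp add: dStirling1_def fps_compose_nth sum_distrib_left mult_ac)

lemma dEuler_dlog1p_compose_nth:
  assumes "n \<ge> 1"
  shows "((2 / (dexp lam 1 + 1) * dexp lam 1) oo dlog1p lam) $ n = (-1) ^ (n - 1) / 2 ^ n"
proof -
  let ?e = "dexp lam 1" and ?L = "dlog1p lam"
  let ?F = "2 * ?e * inverse (?e + 1)"
  have L0: "?L $ 0 = 0" by (simp add: dlog1p_def fps_inv_def)
  have e: "?e oo ?L = 1 + fps_X"
    using dlog1p_compose(2) [of lam] by (simp add: fps_compose_sub_distrib algebra_simps)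
  define Q where "Q = ?F oo ?L"
  have "?F * (?e + 1) = 2 * ?e"
    using dexp_plus_1_cancel [of lam] by (simp add: mult_ac)
  \<comment> \<open>Composing the product identity rather than the quotient avoids dividing series:
    \<open>e\<close> becomes \<open>1 + t\<close>, and \<open>Q\<close> is then read off by
    comparing coefficients.\<close>
  then have "(?F oo ?L) * ((?e + 1) oo ?L) = (2 * ?e) oo ?L"
    by (simp only: fps_compose_mult_distrib [OF L0, symmetric])
  then have F: "Q * (2 + fps_X) = 2 * (1 + fps_X)"
    by (simp add: Q_def fps_compose_add_distrib fps_compose_mult_distrib [OF L0] e add_ac)
  have "fps_const 2 * Q + fps_X * Q = fps_const 2 * (1 + fps_X)"
    using F by (simp only: numeral_fps_const distrib_left mult.commute [of Q])
  note coeff = arg_cong [OF this, of "\<lambda>f. f $ Suc j" for j]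
  \<comment> \<open>The right-hand side \<open>2 (1 + t)\<close> contributes only at
    \<open>j = 0\<close>; from then on each coefficient is \<open>-1/2\<close> times the previous
    one.\<close>
  have rec: "2 * Q $ Suc j + Q $ j = (if j = 0 then 2 else 0)" for j
    using coeff [of j] by (simp only: fps_add_nth fps_mult_left_const_nth fps_X_mult_nth) simp
  have F0: "Q $ 0 = 1"
    by (simp add: Q_def fps_mult_nth_0)
  have "Q $ Suc j = (-1) ^ j / 2 ^ Suc j" for j
  proof (induction j)
    case 0
    show ?case using rec [of 0] F0 by simp
  next
    case (Suc j)
    then show ?case using rec [of "Suc j"] by simp
  qed
  from this [of "n - 1"] assms show ?thesis by (simp add: dEuler_egf Q_def)
qed

theorem theorem3p4:
  fixes lam :: real
  assumes "lam \<noteq> 0"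
  shows "(\<forall>n. dA_matrix lam n 0 =
              (\<Sum>k=0..n. (-1) ^ k * fact k *
                 (dStirling2 lam (n + 1) (k + 1) + real n * lam * dStirling2 lam n (k + 1)) * (1 / 2) ^ k)
            \<and> (\<Sum>k=0..n. (-1) ^ k * fact k *
                 (dStirling2 lam (n + 1) (k + 1) + real n * lam * dStirling2 lam n (k + 1)) * (1 / 2) ^ k)
              = dEuler lam n 1)
       \<and> (\<forall>n\<ge>1. (\<Sum>k=0..n. dStirling1 lam n k * dEuler lam k 1) = (-1) ^ (n - 1) * fact n / 2 ^ n)"
proof (intro conjI allI impI)
  fix n
  show "dA_matrix lam n 0 =
      (\<Sum>k=0..n. (-1) ^ k * fact k *
         (dStirling2 lam (n + 1) (k + 1) + real n * lam * dStirling2 lam n (k + 1)) * (1 / 2) ^ k)"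
    by (simp only: dA_matrix_eq_dEuler dEuler_eq_sum_dStirling2)
next
  fix n :: nat
  assume "n \<ge> 1"
  then show "(\<Sum>k=0..n. dStirling1 lam n k * dEuler lam k 1) = (-1) ^ (n - 1) * fact n / 2 ^ n"
    by (simp only: dEuler_def sum_dStirling1 dEuler_dlog1p_compose_nth) simp
qed (rule dEuler_eq_sum_dStirling2)

end
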